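(* Let $r,\tilde r\in\mathbb{N}$ and $1\le p\le\infty$. For each abstract modulus of smoothness $\omega$ satisfying $\lim_{\delta\to0+}\omega(\delta)/\delta=\infty$ there exists $f_\omega\in X^p[0,1]$ such that $$\omega_r(f_\omega,\delta)_p=O(\omega(\delta^r))\quad(\delta\to0+)$$ and $$E(S_n^{\tilde r},f_\omega)_p:=\inf\{\|f_\omega-g\|_{X^p[0,1]}:g\in S_n^{\tilde r}\}\ne o\Big(\omega\Big(\frac{1}{n^r}\Big)\Big)\quad(n\to\infty).$$
   Context: $\mathbb{N}=\{1,2,\dots\}$. $X^\infty[0,1]:=C[0,1]$ with $\|f\|_{X^\infty[0,1]}:=\sup_{x\in[0,1]}|f(x)|$ (this sup-norm is also used for bounded, possibly discontinuous functions), and $X^p[0,1]:=L^p[0,1]$ with $\|f\|_{X^p[0,1]}:=(\int_0^1|f(x)|^p\,dx)^{1/p}$ for $1\le p<\infty$. $S_n^{\tilde r}$ is the space of functions $f$ on $[0,1]$ for which there exist $n+1$ open intervals $(x_k,x_{k+1})$, $0=x_0<x_1<\dots<x_{n+1}=1$, such that on each of these intervals $f$ equals a (potentially different) algebraic polynomial of degree less than $\tilde r$; no smoothness conditions are required at the knots, and the knots may depend on $f$. With $\Delta_h^rf(x):=\sum_{j=0}^r(-1)^{r-j}\binom rj f(x+jh)$, the $r$th moduli of smoothness are $\omega_r(f,\delta)_\infty:=\sup\{|\Delta_h^rf(x)|:x\in[0,1-rh],\,0<h\le\delta\}$ and $\omega_r(f,\delta)_p:=\sup\{(\int_0^{1-rh}|\Delta_h^rf(x)|^p\,dx)^{1/p}:0<h\le\delta\}$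 for $1\le p<\infty$ (only step sizes with $rh\le1$ contribute). An abstract modulus of smoothness is a continuous, increasing (non-decreasing) function $\omega$ on $[0,\infty)$ with $0=\omega(0)<\omega(\delta_1)\le\omega(\delta_1+\delta_2)\le\omega(\delta_1)+\omega(\delta_2)$ for all $\delta_1,\delta_2>0$. *)

theory Defs
  imports "HOL-Analysis.Analysis" "HOL-Library.Landau_Symbols"
    "HOL-Computational_Algebra.Polynomial"
begin

text \<open>
  Functions on \<open>[0,1]\<close> are represented by total functions of type \<^typ>\<open>real \<Rightarrow> real\<close>; nothing below
  depends on their values outside \<open>[0,1]\<close>. The exponent \<open>p\<close> ranges over \<open>1 \<le> p \<le> \<infinity>\<close> in
  \<^typ>\<open>ennreal\<close>. The norms and moduli are real-valued; the suprema, infima and integrals are taken only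
  where they are finite: for \<open>f\<close> in \<open>X_space p\<close> and differences of such \<open>f\<close> with piecewise polynomials.
\<close>

text \<open>For \<open>p < \<infinity>\<close> the elements are representatives of classes in \<open>L\<^sup>p[0,1]\<close>.\<close>

definition X_space :: "ennreal \<Rightarrow> (real \<Rightarrow> real) set" where
  "X_space p =
     (if p = \<infinity> then {f. continuous_on {0..1} f}
      else {f. f \<in> borel_measurable (lebesgue_on {0..1}) \<and>
               integrable (lebesgue_on {0..1}) (\<lambda>x. \<bar>f x\<bar> powr enn2real p)})"

definition X_norm :: "ennreal \<Rightarrow> (real \<Rightarrow> real) \<Rightarrow> real" where
  "X_norm p f =
     (if p = \<infinity> then (SUP x\<in>{0..1}. \<bar>f x\<bar>)
      else (integral\<^sup>L (lebesgue_on {0..1}) (\<lambda>x. \<bar>f x\<bar> powr enn2real p)) powr (1 / enn2real p))"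

text \<open>The knots \<open>x\<^sub>0 < \<dots> < x\<^bsub>n+1\<^esub>\<close> may depend on the function, and its values at the knots are
  unconstrained. As \<^term>\<open>degree 0 = 0\<close>, the degree bound is the intended one for \<open>m \<ge> 1\<close>.\<close>

definition spline_space :: "nat \<Rightarrow> nat \<Rightarrow> (real \<Rightarrow> real) set" where
  "spline_space m n =
     {f. \<exists>x :: nat \<Rightarrow> real. x 0 = 0 \<and> x (n + 1) = 1 \<and> (\<forall>k\<le>n. x k < x (k + 1)) \<and>
           (\<forall>k\<le>n. \<exists>q :: real poly. degree q < m \<and> (\<forall>t\<in>{x k<..<x (k + 1)}. f t = poly q t))}"

definition best_approx_error :: "ennreal \<Rightarrow> (real \<Rightarrow> real) set \<Rightarrow> (real \<Rightarrow> real) \<Rightarrow> real" where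
  "best_approx_error p S f = (INF g\<in>S. X_norm p (\<lambda>x. f x - g x))"

definition fwd_diff :: "nat \<Rightarrow> real \<Rightarrow> (real \<Rightarrow> real) \<Rightarrow> real \<Rightarrow> real" where
  "fwd_diff r h f x = (\<Sum>j=0..r. (-1) ^ (r - j) * real (r choose j) * f (x + real j * h))"

definition smoothness_modulus :: "nat \<Rightarrow> ennreal \<Rightarrow> (real \<Rightarrow> real) \<Rightarrow> real \<Rightarrow> real" where
  "smoothness_modulus r p f \<delta> =
     (if p = \<infinity>
      then Sup {\<bar>fwd_diff r h f x\<bar> | x h. 0 < h \<and> h \<le> \<delta> \<and> real r * h \<le> 1 \<and> x \<in> {0..1 - real r * h}}
      else Sup {(integral\<^sup>L (lebesgue_on {0..1 - real r * h}) (\<lambda>x. \<bar>fwd_diff r h f x\<bar> powr enn2real p))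
                  powr (1 / enn2real p) | h. 0 < h \<and> h \<le> \<delta> \<and> real r * h \<le> 1})"

definition abstract_modulus :: "(real \<Rightarrow> real) \<Rightarrow> bool" where
  "abstract_modulus \<omega> \<longleftrightarrow>
     continuous_on {0..} \<omega> \<and> mono_on {0..} \<omega> \<and> \<omega> 0 = 0 \<and>
     (\<forall>\<delta>\<^sub>1>0. \<forall>\<delta>\<^sub>2>0. 0 < \<omega> \<delta>\<^sub>1 \<and> \<omega> \<delta>\<^sub>1 \<le> \<omega> (\<delta>\<^sub>1 + \<delta>\<^sub>2) \<and> \<omega> (\<delta>\<^sub>1 + \<delta>\<^sub>2) \<le> \<omega> \<delta>\<^sub>1 + \<omega> \<delta>\<^sub>2)"

end

theory Submission
  imports Defs
begin

text \<open>
  The function is a lacunary sine series \<open>f(x) = \<Sum>\<^sub>k c\<^sub>k sin (N\<^sub>k x)\<close> with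
  \<open>c\<^sub>k = \<omega>(n\<^sub>k\<^sup>-\<^sup>r)\<close> and \<open>N\<^sub>k = 2 \<pi> (m + 1) n\<^sub>k\<close>, where \<open>m = max r r'\<close>. It is continuous, and it
  serves every \<open>p\<close> at once: on an interval of length at most one, \<open>p\<close>-norms are at most the sup-norm
  and at least the \<open>1\<close>-norm, so the smoothness is estimated uniformly and the approximation error
  in mean. As \<open>\<omega>(t) \<rightarrow> 0\<close> and \<open>\<omega>(t) / t \<rightarrow> \<infinity>\<close> for \<open>t \<rightarrow> 0+\<close>, the \<open>n\<^sub>k\<close> can be chosen so sparse that
  at every step \<open>c\<^sub>k\<close> decreases and \<open>c\<^sub>k n\<^sub>k\<^sup>r\<close> increases at least by a large constant factor
  (\<open>exists_lacunary_sequence\<close>).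

  Smoothness: on \<open>e\<^sup>i\<^sup>N\<^sup>x\<close> the \<open>r\<close>th difference of step \<open>h\<close> is multiplication by
  \<open>(e\<^sup>i\<^sup>N\<^sup>h - 1)\<^sup>r\<close>, so that of \<open>sin (N x)\<close> is at most \<open>(min 2 (N h))\<^sup>r\<close>. Hence the difference of \<open>f\<close>
  is at most a constant times \<open>\<Sum>\<^sub>k c\<^sub>k min 1 (n\<^sub>k h)\<^sup>r\<close>. In this sum the frequencies beyond \<open>1/h\<close> are
  dominated by the first of them, the others by the last of them, and both dominant terms are
  \<open>O(\<omega>(h\<^sup>r))\<close> (\<open>lacunary_sum_le_modulus\<close>).

  Approximation: let \<open>n = n\<^sub>k\<close>, let \<open>h = \<pi> / N\<^sub>k\<close> be half a period of the \<open>k\<close>th wave, and cut \<open>[0,1]\<close> into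
  \<open>2 n\<close> cells of length \<open>(m + 1) h\<close>. A piecewise polynomial with \<open>n\<close> interior knots leaves at least
  \<open>n\<close> of these cells free of knots, and there its \<open>m\<close>th difference vanishes. The \<open>m\<close>th difference of
  the \<open>k\<close>th wave is the wave itself times \<open>(-2)\<^sup>m\<close>. Sparsity makes the contribution of all other waves
  a small fraction of \<open>c\<^sub>k\<close>: the later ones have small amplitudes, and the earlier ones have small
  differences because \<open>m \<ge> r\<close>. So on half of \<open>[0,1]\<close> the mean error is at least a
  constant times \<open>c\<^sub>k = \<omega>(n\<^sup>-\<^sup>r)\<close>. Taking \<open>m\<close> at least \<open>r\<close>, which only enlarges the spline space, is what
  keeps the smooth partial sums under control when \<open>r' < r\<close>: in that case piecewise polynomials of
  degree below \<open>r'\<close> need not approximate them to the order \<open>n\<^sup>-\<^sup>r\<close>.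
\<close>

section \<open>Abstract moduli and lacunary sequences\<close>

lemma abstract_modulus_pos: "abstract_modulus \<omega> \<Longrightarrow> 0 < t \<Longrightarrow> 0 < \<omega> t"
  unfolding abstract_modulus_def by (metis zero_less_one)

lemma abstract_modulus_mono:
  "abstract_modulus \<omega> \<Longrightarrow> 0 \<le> s \<Longrightarrow> s \<le> t \<Longrightarrow> \<omega> s \<le> \<omega> t"
  unfolding abstract_modulus_def mono_on_def by simp

lemma abstract_modulus_of_nat_mult:
  assumes "abstract_modulus \<omega>" "0 < t"
  shows "\<omega> (real (Suc n) * t) \<le> real (Suc n) * \<omega> t"
proof (induction n)
  case (Suc n)
  have "\<omega> (real (Suc n) * t + t) \<le> \<omega> (real (Suc n) * t) + \<omega> t"
    using assms unfolding abstract_modulus_def by simp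
  with Suc show ?case by (simp add: algebra_simps)
qed simp

text \<open>
  Subadditivity bounds \<open>\<omega>\<close> at an integer multiple of \<open>t\<close>; rounding \<open>s / t\<close> up to an integer costs
  at most the factor \<open>2\<close>.
\<close>

lemma abstract_modulus_quotient_le:
  assumes \<omega>: "abstract_modulus \<omega>" and "0 < t" "t \<le> s"
  shows "\<omega> s / s \<le> 2 * (\<omega> t / t)"
proof -
  define k where "k = nat \<lfloor>s / t\<rfloor>"
  have "1 \<le> s / t" using assms by simp
  then have k: "real k \<le> s / t" "s / t < real k + 1"
    unfolding k_def by linarith+
  have "\<omega> s \<le> \<omega> (real (Suc k) * t)"
    using k assms by (intro abstract_modulus_mono[OF \<omega>]) (auto simp: field_simps)
  also have "\<dots> \<le> real (Suc k) * \<omega> t"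
    by (rule abstract_modulus_of_nat_mult[OF \<omega> \<open>0 < t\<close>])
  also have "\<dots> \<le> (2 * (s / t)) * \<omega> t"
    using k \<open>1 \<le> s / t\<close> abstract_modulus_pos[OF \<omega> \<open>0 < t\<close>] by (intro mult_right_mono) auto
  finally show ?thesis using assms by (simp add: field_simps)
qed

lemma abstract_modulus_tendsto_0:
  assumes "abstract_modulus \<omega>"
  shows "(\<omega> \<longlongrightarrow> 0) (at_right 0)"
proof -
  have "continuous_on {0..} \<omega>" "\<omega> 0 = 0"
    using assms unfolding abstract_modulus_def by auto
  then have "(\<omega> \<longlongrightarrow> 0) (at 0 within {0..})"
    by (metis atLeast_iff continuous_on order_refl)
  then show ?thesis by (rule tendsto_within_subset) auto
qed

text \<open>
  A factor \<open>\<epsilon>\<close> can be gained simultaneously in \<open>\<omega>(t)\<close>, which tends to \<open>0\<close>, and in the reciprocal of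
  \<open>\<omega>(t) / t\<close>, which tends to \<open>\<infinity>\<close>, by going from one \<open>t = n\<^sup>-\<^sup>r\<close> to a sufficiently small later one.
  Without the growth of \<open>\<omega>(t) / t\<close> the second gain would be impossible.
\<close>

lemma exists_lacunary_sequence:
  fixes \<omega> :: "real \<Rightarrow> real"
  assumes \<omega>: "abstract_modulus \<omega>"
    and steep: "filterlim (\<lambda>\<delta>. \<omega> \<delta> / \<delta>) at_top (at_right 0)"
    and "r \<ge> 1" and "0 < \<epsilon>"
  shows "\<exists>n :: nat \<Rightarrow> nat. (\<forall>k. 1 \<le> n k) \<and> strict_mono n \<and>
    (\<forall>k. \<omega> (1 / real (n (Suc k)) ^ r) \<le> \<epsilon> * \<omega> (1 / real (n k) ^ r)) \<and>
    (\<forall>k. \<omega> (1 / real (n k) ^ r) * real (n k) ^ r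
        \<le> \<epsilon> * (\<omega> (1 / real (n (Suc k)) ^ r) * real (n (Suc k)) ^ r))"
proof -
  define t where "t n = 1 / real n ^ r" for n :: nat
  have t_lim: "filterlim t (at_right 0) sequentially"
    unfolding filterlim_at
  proof
    show "\<forall>\<^sub>F n in sequentially. t n \<in> {0<..} \<and> t n \<noteq> 0"
      using eventually_gt_at_top[of 0] by eventually_elim (simp add: t_def)
    have "(\<lambda>n. inverse (real n ^ r)) \<longlonglongrightarrow> 0"
      using \<open>r \<ge> 1\<close> by (intro tendsto_inverse_0_at_top filterlim_pow_at_top filterlim_real_sequentially) simp
    then show "t \<longlonglongrightarrow> 0" by (simp add: t_def[abs_def] inverse_eq_divide)
  qed
  define P where "P n m \<longleftrightarrow> 1 \<le> m \<and> n < m \<and> \<omega> (t m) \<le> \<epsilon> * \<omega> (t n) \<and>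
    \<omega> (t n) / t n \<le> \<epsilon> * (\<omega> (t m) / t m)" for n m
  have ex: "\<exists>m. P n m" if "1 \<le> n" for n
  proof -
    have "0 < \<epsilon> * \<omega> (t n)"
      using \<open>0 < \<epsilon>\<close> abstract_modulus_pos[OF \<omega>, of "t n"] that by (simp add: t_def)
    moreover have "((\<lambda>m. \<omega> (t m)) \<longlongrightarrow> 0) sequentially"
      by (rule filterlim_compose[OF abstract_modulus_tendsto_0[OF \<omega>] t_lim])
    ultimately have "\<forall>\<^sub>F m in sequentially. \<omega> (t m) < \<epsilon> * \<omega> (t n)"
      by (intro order_tendstoD(2))
    moreover have "\<forall>\<^sub>F m in sequentially. (\<omega> (t n) / t n) / \<epsilon> \<le> \<omega> (t m) / t m"
      using filterlim_compose[OF steep t_lim] unfolding filterlim_at_top by blast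
    ultimately have "\<forall>\<^sub>F m in sequentially. P n m"
      using eventually_gt_at_top[of n] eventually_ge_at_top[of 1]
    proof eventually_elim
      case (elim m)
      from elim(2) \<open>0 < \<epsilon>\<close> have "\<omega> (t n) / t n \<le> \<epsilon> * (\<omega> (t m) / t m)"
        by (simp only: pos_divide_le_eq mult.commute)
      with elim show ?case by (simp add: P_def)
    qed
    then show ?thesis using eventually_happens by force
  qed
  have "\<exists>n. \<forall>k. 1 \<le> n k \<and> P (n k) (n (Suc k))"
    by (rule dependent_nat_choice) (use ex in \<open>auto simp: P_def\<close>)
  then obtain n where n: "\<And>k. 1 \<le> n k" "\<And>k. P (n k) (n (Suc k))" by blast
  show ?thesis
    by (intro exI[of _ n]) (use n in \<open>auto simp: P_def t_def strict_mono_Suc_iff\<close>)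
qed

text \<open>
  The sum of the first terms of a sequence growing at least geometrically is governed by the last of
  them, which is in turn a small fraction of the next one.
\<close>

lemma head_sum_le:
  fixes b :: "nat \<Rightarrow> real"
  assumes "0 \<le> \<epsilon>" "\<epsilon> \<le> 1 / 2" and "\<And>k. 0 \<le> b k" and "\<And>k. b k \<le> \<epsilon> * b (Suc k)"
  shows "(\<Sum>j<k. b j) \<le> 2 * \<epsilon> * b k"
proof (induction k)
  case 0
  then show ?case using assms by simp
next
  case (Suc k)
  have "2 * \<epsilon> * b k \<le> 1 * b k"
    using assms by (intro mult_right_mono) auto
  with Suc assms(4)[of k] show ?case by simp
qed

text \<open>
  The remainders of a series decreasing at least geometrically are governed by their first term.
\<close>

lemma tail_sum:
  fixes c :: "nat \<Rightarrow> real"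
  assumes "0 \<le> \<epsilon>" "\<epsilon> \<le> 1 / 2" and "\<And>k. 0 \<le> c k" and "\<And>k. c (Suc k) \<le> \<epsilon> * c k"
  shows "summable c" and "(\<Sum>j. c (j + k)) \<le> 2 * c k"
proof -
  have half: "c (Suc k) \<le> (1 / 2) * c k" for k
    using assms(4)[of k] mult_right_mono[OF assms(2) assms(3)[of k]] by simp
  have geom: "c (j + k) \<le> c k * (1 / 2) ^ j" for j k
  proof (induction j)
    case (Suc j)
    with half[of "j + k"] show ?case by simp
  qed simp
  have geo: "(\<lambda>j. c k * (1 / 2) ^ j) sums (c k * 2)" for k
    using sums_mult[OF geometric_sums[of "1 / 2 :: real"], of "c k"] by simp
  show "summable c"
    by (rule summable_comparison_test'[where N = 0 and g = "\<lambda>j. c 0 * (1 / 2) ^ j"])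
       (use geo geom[of _ 0] assms(3) in \<open>auto simp: sums_iff\<close>)
  then have "(\<Sum>j. c (j + k)) \<le> (\<Sum>j. c k * (1 / 2) ^ j)"
    using geom geo[of k] by (intro suminf_le) (auto simp: sums_iff)
  also have "\<dots> = 2 * c k" using geo[of k] by (simp add: sums_iff)
  finally show "(\<Sum>j. c (j + k)) \<le> 2 * c k" .
qed

text \<open>
  Split the sum at the first \<open>K\<close> with \<open>t\<^sub>K \<le> s\<close>. From there on the minimum is at most \<open>1\<close> and the
  terms are dominated by \<open>\<omega>(t\<^sub>K) \<le> \<omega>(s)\<close>. Before \<open>K\<close> the minimum is at most \<open>s / t\<^sub>k\<close>, and the terms
  are dominated by the last one, which is at most \<open>2 \<omega>(s)\<close> because \<open>\<omega>(t) / t\<close> is almost decreasing.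
\<close>

lemma lacunary_sum_le_modulus:
  fixes t :: "nat \<Rightarrow> real"
  assumes \<omega>: "abstract_modulus \<omega>" and \<epsilon>: "0 \<le> \<epsilon>" "\<epsilon> \<le> 1 / 2"
    and t: "\<And>k. 0 < t k" "t \<longlonglongrightarrow> 0"
    and decay: "\<And>k. \<omega> (t (Suc k)) \<le> \<epsilon> * \<omega> (t k)"
    and growth: "\<And>k. \<omega> (t k) / t k \<le> \<epsilon> * (\<omega> (t (Suc k)) / t (Suc k))"
    and "0 < s"
  shows "(\<Sum>k. \<omega> (t k) * min 1 (s / t k)) \<le> 6 * \<omega> s"
proof -
  define c where "c k = \<omega> (t k)" for k
  define d where "d k = c k * min 1 (s / t k)" for k
  have c: "0 < c k" for k unfolding c_def by (rule abstract_modulus_pos[OF \<omega> t(1)])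
  have tail: "summable c" "(\<Sum>j. c (j + k)) \<le> 2 * c k" for k
    using tail_sum[of \<epsilon> c, OF \<epsilon>] c decay by (auto simp: c_def less_imp_le)
  have d_nonneg: "0 \<le> d k" for k
    using c t(1) \<open>0 < s\<close> by (simp add: d_def less_imp_le)
  have d_le_c: "d k \<le> c k" for k
    unfolding d_def using mult_left_mono[of "min 1 (s / t k)" 1 "c k"] c[of k] by simp
  have d_summable: "summable d"
    by (rule summable_comparison_test'[OF tail(1), where N = 0])
       (use d_nonneg d_le_c in auto)
  have "\<forall>\<^sub>F k in sequentially. t k < s" by (rule order_tendstoD(2)[OF t(2) \<open>0 < s\<close>])
  then have ex: "\<exists>k. t k \<le> s" using eventually_happens by (force intro: less_imp_le)
  define K where "K = (LEAST k. t k \<le> s)"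
  have K: "t K \<le> s" unfolding K_def using ex by (rule LeastI_ex)
  have before: "s < t k" if "k < K" for k
    using not_less_Least[of k "\<lambda>k. t k \<le> s"] that unfolding K_def by auto
  have "(\<Sum>j. d (j + K)) \<le> (\<Sum>j. c (j + K))"
    using d_le_c d_summable tail(1) by (intro suminf_le) auto
  also have "\<dots> \<le> 2 * c K" by (rule tail(2))
  also have "c K \<le> \<omega> s"
    unfolding c_def by (rule abstract_modulus_mono[OF \<omega> less_imp_le[OF t(1)] K])
  finally have tail_le: "(\<Sum>j. d (j + K)) \<le> 2 * \<omega> s" by simp
  have head_le: "(\<Sum>j<K. d j) \<le> 4 * \<omega> s"
  proof (cases K)
    case 0
    then show ?thesis using abstract_modulus_pos[OF \<omega> \<open>0 < s\<close>] by simp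
  next
    case (Suc k)
    define b where "b j = c j / t j" for j
    have b: "0 \<le> b j" "b j \<le> \<epsilon> * b (Suc j)" for j
      using c[of j] t(1)[of j] growth by (auto simp: b_def c_def)
    have "d j \<le> s * b j" for j
      unfolding d_def b_def using mult_left_mono[of "min 1 (s / t j)" "s / t j" "c j"] c[of j]
      by (simp add: mult.commute)
    then have "(\<Sum>j<K. d j) \<le> s * (\<Sum>j<K. b j)"
      unfolding sum_distrib_left by (intro sum_mono)
    also have "(\<Sum>j<K. b j) \<le> 2 * b k"
      using head_sum_le[of \<epsilon> b k, OF \<epsilon> b] mult_right_mono[OF \<epsilon>(2) b(1)[of k]]
      by (simp add: Suc)
    also have "s * (2 * b k) \<le> s * (2 * (2 * (\<omega> s / s)))"
      unfolding b_def c_def using before[of k] \<open>0 < s\<close> Suc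
      by (intro mult_left_mono abstract_modulus_quotient_le[OF \<omega>]) auto
    also have "\<dots> = 4 * \<omega> s" using \<open>0 < s\<close> by simp
    finally show ?thesis using \<open>0 < s\<close> by simp
  qed
  have "(\<Sum>k. d k) = (\<Sum>j. d (j + K)) + (\<Sum>j<K. d j)"
    by (rule suminf_split_initial_segment[OF d_summable])
  with tail_le head_le have "(\<Sum>k. d k) \<le> 6 * \<omega> s" by simp
  then show ?thesis by (simp add: d_def c_def)
qed

section \<open>Finite differences\<close>

lemma fwd_diff_Suc:
  "fwd_diff (Suc r) h f x = fwd_diff r h (\<lambda>y. f (y + h) - f y) x"
proof -
  define a where "a j = f (x + real j * h)" for j :: nat
  have shift: "f (x + real j * h + h) = a (Suc j)" for j
    by (simp add: a_def algebra_simps)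
  have sign: "(-1::real) ^ (r - j) * real (r choose Suc j)
      = - ((-1) ^ (r - Suc j) * real (r choose Suc j))" if "j \<le> r" for j
  proof (cases "j = r")
    case False
    with that have "r - j = Suc (r - Suc j)" by simp
    then show ?thesis by simp
  qed simp
  \<comment> \<open>The index is extended to \<open>Suc r\<close>, where the binomial coefficient vanishes, and then shifted.\<close>
  have ext: "(\<Sum>j\<le>r. (-1) ^ (r - j) * real (r choose j) * a j)
      = (-1) ^ r * a 0 + (\<Sum>j\<le>r. (-1) ^ (r - Suc j) * real (r choose Suc j) * a (Suc j))"
    (is "?S = _")
  proof -
    have "?S = (\<Sum>j\<le>Suc r. (-1) ^ (r - j) * real (r choose j) * a j)" by simp
    also have "\<dots> = (-1) ^ r * a 0 + (\<Sum>j\<le>r. (-1) ^ (r - Suc j) * real (r choose Suc j) * a (Suc j))"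
      by (subst sum.atMost_Suc_shift) simp
    finally show ?thesis .
  qed
  have "fwd_diff (Suc r) h f x = (\<Sum>j\<le>Suc r. (-1) ^ (Suc r - j) * real (Suc r choose j) * a j)"
    by (simp add: fwd_diff_def a_def atLeast0AtMost del: sum.atMost_Suc)
  also have "\<dots> = (-1) ^ Suc r * a 0
      + (\<Sum>j\<le>r. (-1) ^ (r - j) * (real (r choose Suc j) + real (r choose j)) * a (Suc j))"
    by (subst sum.atMost_Suc_shift) (simp add: add.commute)
  also have "\<dots> = (-1) ^ Suc r * a 0
      + (\<Sum>j\<le>r. (-1) ^ (r - j) * real (r choose Suc j) * a (Suc j))
      + (\<Sum>j\<le>r. (-1) ^ (r - j) * real (r choose j) * a (Suc j))"
    by (simp add: algebra_simps sum.distrib)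
  also have "(\<Sum>j\<le>r. (-1) ^ (r - j) * real (r choose Suc j) * a (Suc j))
      = - (\<Sum>j\<le>r. (-1) ^ (r - Suc j) * real (r choose Suc j) * a (Suc j))"
    unfolding sum_negf[symmetric] by (rule sum.cong) (simp_all only: atMost_iff sign mult_minus_left)
  also have "(-1) ^ Suc r * a 0 + \<dots> + (\<Sum>j\<le>r. (-1) ^ (r - j) * real (r choose j) * a (Suc j))
      = (\<Sum>j\<le>r. (-1) ^ (r - j) * real (r choose j) * a (Suc j)) - ?S"
    unfolding ext by simp
  also have "\<dots> = fwd_diff r h (\<lambda>y. f (y + h) - f y) x"
    by (simp add: fwd_diff_def shift atLeast0AtMost right_diff_distrib sum_subtractf)
       (simp add: a_def)
  finally show ?thesis .
qed

text \<open>
  A first difference lowers the degree of a polynomial, so \<open>m\<close> of them annihilate degree below \<open>m\<close>.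
\<close>

lemma fwd_diff_poly_eq_0:
  fixes q :: "real poly"
  assumes "degree q < m"
  shows "fwd_diff m h (poly q) x = 0"
  using assms
proof (induction m arbitrary: q)
  case (Suc m)
  define d where "d = pcompose q [:h, 1:] - q"
  have eq: "(\<lambda>y. poly q (y + h) - poly q y) = poly d"
    by (auto simp: d_def poly_pcompose add.commute)
  show ?case
  proof (cases "degree q = 0")
    case True
    then obtain c where "q = [:c:]" by (rule degree_eq_zeroE)
    then have "fwd_diff (Suc m) h (poly q) x = fwd_diff m h (\<lambda>y. 0) x"
      by (simp add: fwd_diff_Suc)
    then show ?thesis by (simp add: fwd_diff_def)
  next
    case False
    have deg: "degree (pcompose q [:h, 1:]) = degree q"
      by (simp add: degree_pcompose)
    have lead: "coeff d (degree q) = 0"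
      using lead_coeff_comp[of "[:h, 1:]" q] by (simp add: d_def deg)
    have "degree d < degree q"
    proof (rule degree_lessI)
      show "\<forall>k\<ge>degree q. coeff d k = 0"
      proof (intro allI impI)
        fix k assume "degree q \<le> k"
        then show "coeff d k = 0"
        proof (cases "k = degree q")
          case True
          then show ?thesis using lead by simp
        next
          case False
          with \<open>degree q \<le> k\<close> have "degree q < k" by simp
          then show ?thesis by (simp add: d_def coeff_eq_0 deg)
        qed
      qed
    qed (use False in simp)
    with Suc show ?thesis by (simp add: fwd_diff_Suc eq)
  qed
qed simp

lemma fwd_diff_minus:
  "fwd_diff r h (\<lambda>x. f x - g x) x = fwd_diff r h f x - fwd_diff r h g x"
  by (simp add: fwd_diff_def right_diff_distrib sum_subtractf)

lemma fwd_diff_sums: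
  assumes "\<And>y. (\<lambda>k. c k * G k y) sums F y"
  shows "(\<lambda>k. c k * fwd_diff r h (G k) x) sums fwd_diff r h F x"
proof -
  have "(\<lambda>k. \<Sum>j=0..r. (-1) ^ (r - j) * real (r choose j) * (c k * G k (x + real j * h)))
      sums (\<Sum>j=0..r. (-1) ^ (r - j) * real (r choose j) * F (x + real j * h))"
    by (intro sums_sum sums_mult assms)
  then show ?thesis
    by (simp add: fwd_diff_def sum_distrib_left algebra_simps)
qed

lemma abs_fwd_diff_le:
  "\<bar>fwd_diff m h u x\<bar> \<le> 2 ^ m * (\<Sum>j\<le>m. \<bar>u (x + real j * h)\<bar>)"
proof -
  have "\<bar>fwd_diff m h u x\<bar> \<le> (\<Sum>j\<le>m. \<bar>(-1) ^ (m - j) * real (m choose j) * u (x + real j * h)\<bar>)"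
    unfolding fwd_diff_def atLeast0AtMost by (rule sum_abs)
  also have "\<dots> = (\<Sum>j\<le>m. real (m choose j) * \<bar>u (x + real j * h)\<bar>)"
    by (simp add: abs_mult power_abs)
  also have "\<dots> \<le> (\<Sum>j\<le>m. 2 ^ m * \<bar>u (x + real j * h)\<bar>)"
  proof (intro sum_mono mult_right_mono)
    fix j
    show "real (m choose j) \<le> 2 ^ m"
      using binomial_le_pow2[of m j] by (metis of_nat_le_iff of_nat_numeral of_nat_power)
  qed simp
  finally show ?thesis by (simp add: sum_distrib_left)
qed

text \<open>
  A shift by \<open>h\<close> multiplies \<open>e\<^sup>i\<^sup>N\<^sup>x\<close> by \<open>e\<^sup>i\<^sup>N\<^sup>h\<close>. A difference of order \<open>r\<close> therefore multiplies it by the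
  binomial expansion of \<open>(e\<^sup>i\<^sup>N\<^sup>h - 1)\<^sup>r\<close>, and the sine is the imaginary part.
\<close>

lemma fwd_diff_sin:
  "fwd_diff r h (\<lambda>x. sin (N * x)) x = Im (cis (N * x) * (cis (N * h) - 1) ^ r)"
proof -
  have "(cis (N * h) - 1) ^ r = (\<Sum>j\<le>r. of_nat (r choose j) * cis (N * h) ^ j * (-1) ^ (r - j))"
    using binomial_ring[of "cis (N * h)" "-1" r] by simp
  then have "cis (N * x) * (cis (N * h) - 1) ^ r
      = (\<Sum>j\<le>r. of_real ((-1) ^ (r - j) * real (r choose j)) * cis (N * (x + real j * h)))"
    by (simp add: sum_distrib_left Complex.DeMoivre algebra_simps flip: cis_mult)
  then show ?thesis
    by (simp add: fwd_diff_def atLeast0AtMost del: of_real_mult of_real_power)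
qed

lemma norm_cis_minus_1_le: "norm (cis t - 1) \<le> min 2 \<bar>t\<bar>"
proof -
  have "norm (cis t - 1) = 2 * \<bar>sin (t / 2)\<bar>"
    using dist_exp_i_1[of t] by (simp add: cis_conv_exp)
  moreover have "\<bar>sin (t / 2)\<bar> \<le> \<bar>t / 2\<bar>" by (rule abs_sin_x_le_abs_x)
  moreover have "\<bar>sin (t / 2)\<bar> \<le> 1" by simp
  ultimately show ?thesis by simp
qed

lemma abs_fwd_diff_sin_le:
  "\<bar>fwd_diff r h (\<lambda>x. sin (N * x)) x\<bar> \<le> min 2 \<bar>N * h\<bar> ^ r"
proof -
  have "\<bar>fwd_diff r h (\<lambda>x. sin (N * x)) x\<bar> \<le> norm (cis (N * x) * (cis (N * h) - 1) ^ r)"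
    unfolding fwd_diff_sin by (rule abs_Im_le_cmod)
  also have "\<dots> \<le> min 2 \<bar>N * h\<bar> ^ r"
    unfolding norm_mult norm_power norm_cis mult_1
    by (intro power_mono norm_cis_minus_1_le) simp
  finally show ?thesis .
qed

text \<open>
  A shift by half a period changes the sign, so each first difference of that step multiplies the
  wave by \<open>-2\<close>: the difference operator resonates with this frequency.
\<close>

lemma fwd_diff_sin_half_period:
  assumes "N * h = pi"
  shows "fwd_diff r h (\<lambda>x. sin (N * x)) x = (- 2) ^ r * sin (N * x)"
proof -
  have "(cis (N * h) - 1) ^ r = of_real ((-2) ^ r)" by (simp add: assms cis_pi)
  then show ?thesis unfolding fwd_diff_sin by (simp del: of_real_power)
qed

section \<open>Norms and moduli of smoothness\<close>

lemma one_le_enn2real: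
  assumes "1 \<le> p" "p \<noteq> \<infinity>"
  shows "1 \<le> enn2real p"
  using enn2real_mono[of 1 p] assms by (simp add: top.not_eq_extremum)

text \<open>
  Instead of Jensen's inequality, which would give the bound without the factor \<open>1/2\<close>, it suffices to
  integrate \<open>v \<le> 1 + v\<^sup>p\<close> for \<open>v = \<bar>u\<bar> / (I / 2)\<close>: the left-hand side has integral at least \<open>2\<close>,
  hence \<open>v\<^sup>p\<close> has integral at least \<open>1\<close>. The bound is stated for real-valued integrals, which are \<open>0\<close>
  where they diverge; boundedness and measurability of \<open>u\<close> exclude this.
\<close>

lemma half_integral_le_X_norm:
  assumes p: "1 \<le> p"
    and u: "u \<in> borel_measurable (lebesgue_on {0..1})" "bounded (u ` {0..1})"
    and I: "I \<le> integral\<^sup>L (lebesgue_on {0..1}) (\<lambda>x. \<bar>u x\<bar>)" "0 < I"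
  shows "I / 2 \<le> X_norm p u"
proof -
  obtain B where "\<forall>y\<in>u ` {0..1}. norm y \<le> B"
    using u(2) unfolding bounded_iff by blast
  then have B: "\<bar>u x\<bar> \<le> B" if "x \<in> {0..1}" for x using that by auto
  have fin: "finite_measure (lebesgue_on {0..1::real})"
    by (rule finite_measure_lebesgue_on) simp
  have vol: "measure (lebesgue_on {0..1::real}) (space (lebesgue_on {0..1})) = 1"
    by (simp add: measure_restrict_space space_restrict_space)
  show ?thesis
  proof (cases "p = \<infinity>")
    case True
    define S where "S = (SUP x\<in>{0..1}. \<bar>u x\<bar>)"
    have S: "\<bar>u x\<bar> \<le> S" if "x \<in> {0..1}" for x
      unfolding S_def using that B by (intro cSUP_upper bdd_aboveI2[of _ _ B]) auto
    then have "0 \<le> S" by (force intro: order_trans[OF abs_ge_zero, of "u 0"])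
    with S have "integral\<^sup>L (lebesgue_on {0..1}) (\<lambda>x. \<bar>u x\<bar>) \<le> integral\<^sup>L (lebesgue_on {0..1::real}) (\<lambda>x. S)"
      by (intro Bochner_Integration.integral_mono') (auto simp: space_restrict_space)
    also have "\<dots> = S" using vol by simp
    finally show ?thesis using I by (simp add: X_norm_def True S_def)
  next
    case False
    define q where "q = enn2real p"
    have q: "1 \<le> q" unfolding q_def by (rule one_le_enn2real[OF p False])
    define c where "c = I / 2"
    have "0 < c" using I by (simp add: c_def)
    let ?v = "\<lambda>x. (\<bar>u x\<bar> / c) powr q"
    have int_u: "integrable (lebesgue_on {0..1}) (\<lambda>x. \<bar>u x\<bar> / c)"
    proof (rule finite_measure.integrable_const_bound[OF fin, of _ "B / c"])
      show "AE x in lebesgue_on {0..1}. norm (\<bar>u x\<bar> / c) \<le> B / c"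
        using B \<open>0 < c\<close> by (intro AE_I2) (auto simp: space_restrict_space divide_right_mono)
    qed (use u(1) in simp)
    have int_v: "integrable (lebesgue_on {0..1}) ?v"
    proof (rule finite_measure.integrable_const_bound[OF fin, of _ "(B / c) powr q"])
      show "AE x in lebesgue_on {0..1}. norm (?v x) \<le> (B / c) powr q"
        using B \<open>0 < c\<close> q
        by (intro AE_I2) (auto simp: space_restrict_space divide_right_mono intro!: powr_mono2)
    qed (use u(1) in measurable)
    have "2 \<le> integral\<^sup>L (lebesgue_on {0..1}) (\<lambda>x. \<bar>u x\<bar>) / c"
      using I \<open>0 < c\<close> by (simp add: c_def field_simps)
    also have "\<dots> = integral\<^sup>L (lebesgue_on {0..1}) (\<lambda>x. \<bar>u x\<bar> / c)" by simp
    also have "\<dots> \<le> integral\<^sup>L (lebesgue_on {0..1}) (\<lambda>x. 1 + ?v x)"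
    proof (rule integral_mono[OF int_u])
      show "integrable (lebesgue_on {0..1}) (\<lambda>x. 1 + ?v x)"
        using int_v by simp
      fix x :: real
      show "\<bar>u x\<bar> / c \<le> 1 + ?v x"
      proof (cases "\<bar>u x\<bar> / c \<le> 1")
        case True
        then show ?thesis by (smt (verit) powr_ge_zero)
      next
        case False
        then have "(\<bar>u x\<bar> / c) powr 1 \<le> ?v x" using q by (intro powr_mono) auto
        then show ?thesis using False \<open>0 < c\<close> by simp
      qed
    qed
    also have "\<dots> = 1 + integral\<^sup>L (lebesgue_on {0..1}) ?v"
      using int_v vol by simp
    finally have "1 \<le> integral\<^sup>L (lebesgue_on {0..1}) ?v" by simp
    also have "\<dots> = integral\<^sup>L (lebesgue_on {0..1}) (\<lambda>x. \<bar>u x\<bar> powr q) / c powr q"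
      using \<open>0 < c\<close> by (simp add: powr_divide)
    finally have "c powr q \<le> integral\<^sup>L (lebesgue_on {0..1}) (\<lambda>x. \<bar>u x\<bar> powr q)"
      using \<open>0 < c\<close> by (simp add: field_simps)
    then have "(c powr q) powr (1 / q) \<le> integral\<^sup>L (lebesgue_on {0..1}) (\<lambda>x. \<bar>u x\<bar> powr q) powr (1 / q)"
      using q by (intro powr_mono2) auto
    moreover have "(c powr q) powr (1 / q) = c" using q \<open>0 < c\<close> by (simp add: powr_powr)
    ultimately show ?thesis using False by (simp add: X_norm_def c_def q_def)
  qed
qed

lemma smoothness_modulus_le:
  assumes p: "1 \<le> p" and "0 < \<delta>"
    and W: "\<And>x h. 0 < h \<Longrightarrow> h \<le> \<delta> \<Longrightarrow> \<bar>fwd_diff r h f x\<bar> \<le> W"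
  shows "\<bar>smoothness_modulus r p f \<delta>\<bar> \<le> W"
proof -
  \<comment> \<open>An admissible step: the supremum is over a nonempty set.\<close>
  define h0 where "h0 = min \<delta> (1 / (real r + 1))"
  have h0: "0 < h0" "h0 \<le> \<delta>" "real r * h0 \<le> 1"
  proof -
    have "real r * h0 \<le> real r * (1 / (real r + 1))"
      unfolding h0_def by (intro mult_left_mono) auto
    also have "\<dots> \<le> 1" by (simp add: field_simps)
    finally show "real r * h0 \<le> 1" .
  qed (use \<open>0 < \<delta>\<close> in \<open>auto simp: h0_def\<close>)
  have "0 \<le> W" using W[OF h0(1,2), of 0] by auto
  have sup: "\<bar>Sup A\<bar> \<le> W" if ne: "a \<in> A" and A: "\<And>a. a \<in> A \<Longrightarrow> 0 \<le> a \<and> a \<le> W" for A a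
  proof -
    have "Sup A \<le> W" using ne A by (intro cSup_least) auto
    moreover have "0 \<le> Sup A"
      using ne A by (intro cSup_upper2[of a] bdd_aboveI[of _ W]) auto
    ultimately show ?thesis by simp
  qed
  show ?thesis
  proof (cases "p = \<infinity>")
    case True
    have "\<bar>fwd_diff r h0 f 0\<bar> \<in>
      {\<bar>fwd_diff r h f x\<bar> | x h. 0 < h \<and> h \<le> \<delta> \<and> real r * h \<le> 1 \<and> x \<in> {0..1 - real r * h}}"
      using h0 by force
    then show ?thesis unfolding smoothness_modulus_def True
      using W by (simp del: atLeastAtMost_iff) (rule sup, auto)
  next
    case False
    define q where "q = enn2real p"
    have q: "1 \<le> q" unfolding q_def by (rule one_le_enn2real[OF p False])
    let ?N = "\<lambda>h. (integral\<^sup>L (lebesgue_on {0..1 - real r * h}) (\<lambda>x. \<bar>fwd_diff r h f x\<bar> powr q)) powr (1 / q)"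
    have N: "?N h \<le> W" if h: "0 < h" "h \<le> \<delta>" "real r * h \<le> 1" for h
    proof -
      have "integral\<^sup>L (lebesgue_on {0..1 - real r * h}) (\<lambda>x. \<bar>fwd_diff r h f x\<bar> powr q)
          \<le> integral\<^sup>L (lebesgue_on {0..1 - real r * h}) (\<lambda>x. W powr q)"
        using W[OF h(1,2)] q by (intro Bochner_Integration.integral_mono' powr_mono2) auto
      also have "\<dots> = (1 - real r * h) * W powr q"
        using h by (simp add: measure_restrict_space space_restrict_space)
      also have "\<dots> \<le> 1 * W powr q"
        using h by (intro mult_right_mono) auto
      finally have "?N h \<le> (W powr q) powr (1 / q)"
        using q by (intro powr_mono2) (auto intro: integral_nonneg_AE)
      then show ?thesis using q \<open>0 \<le> W\<close> by (simp add: powr_powr)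
    qed
    have "?N h0 \<in> {?N h | h. 0 < h \<and> h \<le> \<delta> \<and> real r * h \<le> 1}" using h0 by blast
    moreover have "0 \<le> a \<and> a \<le> W" if "a \<in> {?N h | h. 0 < h \<and> h \<le> \<delta> \<and> real r * h \<le> 1}" for a
      using that N by auto
    ultimately have "\<bar>Sup {?N h | h. 0 < h \<and> h \<le> \<delta> \<and> real r * h \<le> 1}\<bar> \<le> W" by (rule sup)
    then show ?thesis unfolding smoothness_modulus_def q_def using False by simp
  qed
qed

lemma continuous_in_X_space:
  assumes "continuous_on {0..1} f"
  shows "f \<in> X_space p"
proof -
  have meas: "f \<in> borel_measurable (lebesgue_on {0..1})"
    by (rule continuous_imp_measurable_on_sets_lebesgue[OF assms]) simp
  have "bounded (f ` {0..1})"
    by (intro compact_imp_bounded compact_continuous_image assms compact_Icc)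
  then obtain B where "\<forall>y\<in>f ` {0..1}. norm y \<le> B"
    unfolding bounded_iff by blast
  then have B: "\<bar>f x\<bar> \<le> B" if "x \<in> {0..1}" for x using that by auto
  have "integrable (lebesgue_on {0..1}) (\<lambda>x. \<bar>f x\<bar> powr enn2real p)"
  proof (rule finite_measure.integrable_const_bound[where B = "B powr enn2real p"])
    show "finite_measure (lebesgue_on {0..1::real})"
      by (rule finite_measure_lebesgue_on) simp
    show "AE x in lebesgue_on {0..1}. norm (\<bar>f x\<bar> powr enn2real p) \<le> B powr enn2real p"
      using B by (intro AE_I2) (auto simp: space_restrict_space intro!: powr_mono2)
  qed (use meas in measurable)
  with meas assms show ?thesis by (simp add: X_space_def)
qed

section \<open>Distance from piecewise polynomials\<close>

text \<open>
  A point that is neither a knot nor in an open piece would lie, by induction along the knots, to the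
  right of all of them.
\<close>

lemma spline_piece_cases:
  fixes x :: "nat \<Rightarrow> real"
  assumes "x 0 = 0" "x (n + 1) = 1" "t \<in> {0..1}"
  shows "(\<exists>k\<le>n. t \<in> {x k<..<x (k + 1)}) \<or> t \<in> x ` {..n + 1}"
proof (rule ccontr)
  assume neg: "\<not> ?thesis"
  have "x k < t" if "k \<le> n + 1" for k
    using that
  proof (induction k)
    case 0
    have "t \<noteq> x 0" using neg by blast
    then show ?case using assms by auto
  next
    case (Suc k)
    then have "x k < t" "k \<le> n" by auto
    with neg have "\<not> t < x (k + 1)" by auto
    moreover have "t \<noteq> x (Suc k)" using neg Suc.prems by blast
    ultimately show ?case by simp
  qed
  from this[of "n + 1"] show False using assms by simp
qed

text \<open>
  The values at the knots are arbitrary, so the open pieces and the single knots are treated as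
  separate members of a finite cover of \<open>[0,1]\<close>.
\<close>

lemma spline_bounded_measurable:
  assumes "g \<in> spline_space m n"
  shows "g \<in> borel_measurable (lebesgue_on {0..1})" and "bounded (g ` {0..1})"
proof -
  obtain x where x: "x 0 = 0" "x (n + 1) = 1"
    and piece: "\<And>k. k \<le> n \<Longrightarrow> \<exists>q. degree q < m \<and> (\<forall>t\<in>{x k<..<x (k + 1)}. g t = poly q t)"
    using assms unfolding spline_space_def by blast
  define C where "C = (\<lambda>k. {x k<..<x (k + 1)}) ` {..n} \<union> (\<lambda>k. {x k}) ` {..n + 1}"
  have finC: "finite C" by (simp add: C_def)
  have cover: "{0..1} \<subseteq> \<Union>C"
    using spline_piece_cases[OF x] unfolding C_def by blast
  have bdd: "bounded (g ` \<Omega>)" and meas: "g \<in> borel_measurable (restrict_space (lebesgue_on {0..1}) \<Omega>)"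
    if \<Omega>: "\<Omega> \<in> C" for \<Omega>
  proof -
    consider k where "k \<le> n" "\<Omega> = {x k<..<x (k + 1)}" | k where "\<Omega> = {x k}"
      using \<Omega> unfolding C_def by blast
    then have "bounded (g ` \<Omega>) \<and> g \<in> borel_measurable (restrict_space (lebesgue_on {0..1}) \<Omega>)"
    proof cases
      case 1
      obtain q where q: "\<And>t. t \<in> \<Omega> \<Longrightarrow> g t = poly q t"
        using piece[OF 1(1)] 1(2) by blast
      have "bounded (poly q ` {x k..x (k + 1)})"
        by (intro compact_imp_bounded compact_continuous_image continuous_intros compact_Icc)
      then have "bounded (g ` \<Omega>)"
        by (rule bounded_subset) (use q 1(2) in force)
      moreover have "poly q \<in> borel_measurable (lebesgue_on {0..1})"
        by (intro continuous_imp_measurable_on_sets_lebesgue continuous_intros) simp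
      then have "poly q \<in> borel_measurable (restrict_space (lebesgue_on {0..1}) \<Omega>)"
        by (rule measurable_restrict_space1)
      then have "g \<in> borel_measurable (restrict_space (lebesgue_on {0..1}) \<Omega>)"
        by (rule measurable_cong[THEN iffD1, rotated]) (simp add: space_restrict_space q)
      ultimately show ?thesis by blast
    next
      case 2
      have "(\<lambda>t. g (x k)) \<in> borel_measurable (restrict_space (lebesgue_on {0..1}) \<Omega>)" by simp
      then have "g \<in> borel_measurable (restrict_space (lebesgue_on {0..1}) \<Omega>)"
        by (rule measurable_cong[THEN iffD1, rotated]) (use 2 in \<open>auto simp: space_restrict_space\<close>)
      then show ?thesis using 2 by simp
    qed
    then show "bounded (g ` \<Omega>)" "g \<in> borel_measurable (restrict_space (lebesgue_on {0..1}) \<Omega>)"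
      by blast+
  qed
  have "bounded (\<Union>\<Omega>\<in>C. g ` \<Omega>)" using finC bdd by blast
  then show "bounded (g ` {0..1})"
    by (rule bounded_subset) (use cover in blast)
  show "g \<in> borel_measurable (lebesgue_on {0..1})"
  proof (rule measurable_piecewise_restrict[OF countable_finite[OF finC]])
    fix \<Omega> assume \<Omega>: "\<Omega> \<in> C"
    then have "\<Omega> \<in> sets borel" by (auto simp: C_def)
    then have "\<Omega> \<in> sets lebesgue" by simp
    then show "\<Omega> \<inter> space (lebesgue_on {0..1}) \<in> sets (lebesgue_on {0..1})"
      by (auto simp: sets_restrict_space space_restrict_space)
    show "g \<in> borel_measurable (restrict_space (lebesgue_on {0..1}) \<Omega>)" by (rule meas[OF \<Omega>])
  qed (use cover in simp)
qed

lemma spline_space_nonempty: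
  assumes "m \<ge> 1"
  shows "spline_space m n \<noteq> {}"
proof -
  have "(\<lambda>t. 0) \<in> spline_space m n"
    unfolding spline_space_def
    by (intro CollectI exI[of _ "\<lambda>k. real k / real (n + 1)"] conjI allI impI exI[of _ 0])
       (use assms in \<open>auto simp: divide_strict_right_mono\<close>)
  then show ?thesis by blast
qed

lemma spline_space_mono:
  assumes "m' \<le> m"
  shows "spline_space m' n \<subseteq> spline_space m n"
proof
  fix g assume "g \<in> spline_space m' n"
  then obtain x :: "nat \<Rightarrow> real" where x: "x 0 = 0" "x (n + 1) = 1" "\<forall>k\<le>n. x k < x (k + 1)"
    and piece: "\<And>k. k \<le> n \<Longrightarrow> \<exists>q. degree q < m' \<and> (\<forall>t\<in>{x k<..<x (k + 1)}. g t = poly q t)"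
    unfolding spline_space_def by blast
  have "\<forall>k\<le>n. \<exists>q. degree q < m \<and> (\<forall>t\<in>{x k<..<x (k + 1)}. g t = poly q t)"
    using piece assms by (meson less_le_trans)
  with x show "g \<in> spline_space m n" unfolding spline_space_def by blast
qed

text \<open>
  Open cells are disjoint, so a knot \<open>x\<^sub>k\<close> spoils at most the cell with number \<open>\<lfloor>x\<^sub>k / L\<rfloor>\<close>.
\<close>

lemma card_cells_with_knot_le:
  fixes x :: "nat \<Rightarrow> real"
  assumes "L > 0"
  shows "card {i. i < M \<and> (\<exists>k\<in>{1..n}. x k \<in> {real i * L <..< real (i + 1) * L})} \<le> n"
proof -
  let ?Bad = "{i. i < M \<and> (\<exists>k\<in>{1..n}. x k \<in> {real i * L <..< real (i + 1) * L})}"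
  have "?Bad \<subseteq> (\<lambda>k. nat \<lfloor>x k / L\<rfloor>) ` {1..n}"
  proof
    fix i assume "i \<in> ?Bad"
    then obtain k where k: "k \<in> {1..n}" "real i * L < x k" "x k < real (i + 1) * L" by auto
    then have "real i < x k / L" "x k / L < real i + 1"
      using assms by (simp_all add: field_simps)
    then have "\<lfloor>x k / L\<rfloor> = int i" by (intro floor_unique) auto
    with k(1) show "i \<in> (\<lambda>k. nat \<lfloor>x k / L\<rfloor>) ` {1..n}" by force
  qed
  then have "card ?Bad \<le> card {1..n}" by (rule surj_card_le[rotated]) simp
  then show ?thesis by simp
qed

text \<open>
  The piece is the one that begins at the last knot not to the right of \<open>a\<close>.
\<close>

lemma cell_inside_piece:
  fixes x :: "nat \<Rightarrow> real"
  assumes "x 0 \<le> a" "b \<le> x (n + 1)" "a < b"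
    and no_knot: "\<And>k. k \<in> {1..n} \<Longrightarrow> x k \<notin> {a<..<b}"
  obtains k where "k \<le> n" "x k \<le> a" "b \<le> x (k + 1)"
proof -
  let ?P = "\<lambda>k. k \<le> n \<and> x k \<le> a"
  define k where "k = (GREATEST k. ?P k)"
  have P0: "?P 0" using assms by simp
  have Pk: "?P k" unfolding k_def
    by (rule GreatestI_nat[of ?P 0 n]) (use P0 in auto)
  have "b \<le> x (k + 1)"
  proof (cases "k = n")
    case False
    then have "k + 1 \<in> {1..n}" using Pk by auto
    moreover have "\<not> ?P (k + 1)"
      using Greatest_le_nat[of ?P "k + 1" n] unfolding k_def[symmetric] by auto
    ultimately show ?thesis using no_knot[of "k + 1"] by auto
  qed (use assms in simp)
  with Pk that show thesis by blast
qed

text \<open>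
  The key estimate, pointwise in the offset \<open>y\<close>. The grid of step \<open>h\<close> is grouped into \<open>2 n\<close> cells of \<open>m + 1\<close>
  nodes each, exactly the nodes of one \<open>m\<close>th difference. On the at least \<open>n\<close> cells without a
  knot, the difference of \<open>g\<close> vanishes, and the difference of \<open>f\<close> is at most \<open>2\<^sup>m\<close> times the sum of the
  errors at the nodes.
\<close>

lemma grid_sum_lower_bound:
  fixes f g :: "real \<Rightarrow> real"
  assumes g: "g \<in> spline_space m n" and "0 < y" "y < h"
    and h: "real (2 * n * (m + 1)) * h = 1"
    and B: "\<And>i. i < 2 * n \<Longrightarrow> 2 ^ m * B \<le> \<bar>fwd_diff m h f (real (i * (m + 1)) * h + y)\<bar>"
  shows "real n * B \<le> (\<Sum>l<2 * n * (m + 1). \<bar>f (real l * h + y) - g (real l * h + y)\<bar>)"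
proof (cases "B \<ge> 0")
  case True
  obtain x where x: "x 0 = 0" "x (n + 1) = 1"
    and poly_piece: "\<And>k. k \<le> n \<Longrightarrow> \<exists>q. degree q < m \<and> (\<forall>t\<in>{x k<..<x (k + 1)}. g t = poly q t)"
    using g unfolding spline_space_def by blast
  define L where "L = real (m + 1) * h"
  define u where "u = (\<lambda>t. f t - g t)"
  define Bad where "Bad = {i. i < 2 * n \<and> (\<exists>k\<in>{1..n}. x k \<in> {real i * L <..< real (i + 1) * L})}"
  have "0 < h" using \<open>0 < y\<close> \<open>y < h\<close> by simp
  then have "0 < L" by (simp add: L_def)
  have nL: "real (2 * n) * L = 1" using h by (simp add: L_def algebra_simps)
  have good: "B \<le> (\<Sum>j\<le>m. \<bar>u (real i * L + y + real j * h)\<bar>)" if i: "i \<in> {..<2 * n} - Bad" for i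
  proof -
    have "i + 1 \<le> 2 * n" using i by auto
    then have "real (i + 1) * L \<le> real (2 * n) * L"
      using \<open>0 < L\<close> by (intro mult_right_mono) (auto simp del: of_nat_mult of_nat_add)
    then have ends: "x 0 \<le> real i * L" "real (i + 1) * L \<le> x (n + 1)" "real i * L < real (i + 1) * L"
      using \<open>0 < L\<close> by (simp_all only: x nL) simp_all
    have avoid: "x k \<notin> {real i * L <..< real (i + 1) * L}" if "k \<in> {1..n}" for k
      using i that by (auto simp: Bad_def)
    obtain k where k: "k \<le> n" "x k \<le> real i * L" "real (i + 1) * L \<le> x (k + 1)"
      using cell_inside_piece[OF ends avoid] .
    obtain q where q: "degree q < m" "\<And>t. t \<in> {x k<..<x (k + 1)} \<Longrightarrow> g t = poly q t"
      using poly_piece[OF k(1)] by blast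
    have node: "g (real i * L + y + real j * h) = poly q (real i * L + y + real j * h)" if "j \<le> m" for j
    proof (rule q(2))
      have "0 \<le> real j * h" using \<open>0 < h\<close> by simp
      moreover have "real j * h \<le> real m * h" using that \<open>0 < h\<close> by simp
      moreover have "real (i + 1) * L = real i * L + real m * h + h"
        by (simp add: L_def algebra_simps)
      ultimately have "real i * L < real i * L + y + real j * h"
        "real i * L + y + real j * h < real (i + 1) * L"
        using \<open>0 < y\<close> \<open>y < h\<close> by linarith+
      with k show "real i * L + y + real j * h \<in> {x k<..<x (k + 1)}" by auto
    qed
    have "fwd_diff m h g (real i * L + y) = fwd_diff m h (poly q) (real i * L + y)"
      unfolding fwd_diff_def by (rule sum.cong) (use node in auto)
    also have "\<dots> = 0" by (rule fwd_diff_poly_eq_0[OF q(1)])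
    finally have "fwd_diff m h u (real i * L + y) = fwd_diff m h f (real i * L + y)"
      by (simp add: u_def fwd_diff_minus)
    then have "2 ^ m * B \<le> \<bar>fwd_diff m h u (real i * L + y)\<bar>"
      using B[of i] i by (simp add: L_def algebra_simps)
    also have "\<dots> \<le> 2 ^ m * (\<Sum>j\<le>m. \<bar>u (real i * L + y + real j * h)\<bar>)"
      by (rule abs_fwd_diff_le)
    finally show ?thesis by simp
  qed
  have "card Bad \<le> n" unfolding Bad_def by (rule card_cells_with_knot_le[OF \<open>0 < L\<close>])
  moreover have "Bad \<subseteq> {..<2 * n}" by (auto simp: Bad_def)
  ultimately have "n \<le> card ({..<2 * n} - Bad)"
    by (subst card_Diff_subset) (auto intro: finite_subset)
  then have "real n * B \<le> real (card ({..<2 * n} - Bad)) * B"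
    using True by (intro mult_right_mono) auto
  also have "\<dots> = (\<Sum>i\<in>{..<2 * n} - Bad. B)" by simp
  also have "\<dots> \<le> (\<Sum>i\<in>{..<2 * n} - Bad. \<Sum>j\<le>m. \<bar>u (real i * L + y + real j * h)\<bar>)"
    by (intro sum_mono good)
  also have "\<dots> \<le> (\<Sum>i<2 * n. \<Sum>j\<le>m. \<bar>u (real i * L + y + real j * h)\<bar>)"
    by (intro sum_mono2) (auto intro: sum_nonneg)
  also have "\<dots> = (\<Sum>i<2 * n. \<Sum>l\<in>{i * (m + 1)..<i * (m + 1) + (m + 1)}. \<bar>u (real l * h + y)\<bar>)"
  proof (rule sum.cong[OF refl])
    fix i
    have "(\<Sum>l\<in>{i * (m + 1)..<i * (m + 1) + (m + 1)}. \<bar>u (real l * h + y)\<bar>)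
        = (\<Sum>j\<in>{0..<m + 1}. \<bar>u (real (j + i * (m + 1)) * h + y)\<bar>)"
      using sum.shift_bounds_nat_ivl[of "\<lambda>l. \<bar>u (real l * h + y)\<bar>" 0 "i * (m + 1)" "m + 1"]
      by (simp add: add.commute)
    also have "\<dots> = (\<Sum>j\<le>m. \<bar>u (real i * L + y + real j * h)\<bar>)"
      by (rule sum.cong) (auto simp: L_def algebra_simps)
    finally show "(\<Sum>j\<le>m. \<bar>u (real i * L + y + real j * h)\<bar>)
      = (\<Sum>l\<in>{i * (m + 1)..<i * (m + 1) + (m + 1)}. \<bar>u (real l * h + y)\<bar>)" by simp
  qed
  also have "\<dots> = (\<Sum>l<2 * n * (m + 1). \<bar>u (real l * h + y)\<bar>)"
    by (rule sum.nat_group)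
  finally show ?thesis by (simp add: u_def)
next
  case False
  then have "real n * B \<le> 0" by (simp add: mult_nonneg_nonpos)
  also have "0 \<le> (\<Sum>l<2 * n * (m + 1). \<bar>f (real l * h + y) - g (real l * h + y)\<bar>)"
    by (rule sum_nonneg) simp
  finally show ?thesis .
qed

text \<open>
  This turns the pointwise grid estimate into one for the integral over \<open>[0,1]\<close>: the \<open>M\<close> subintervals
  of length \<open>h\<close> are translated onto \<open>[0,h]\<close>.
\<close>

lemma integral_eq_grid_sum:
  fixes v :: "real \<Rightarrow> real"
  assumes v: "v integrable_on {0..1}" and "0 < h" "real M * h = 1"
  shows "((\<lambda>y. \<Sum>l<M. v (real l * h + y)) has_integral integral {0..1} v) {0..h}"
proof -
  have "((\<lambda>y. \<Sum>l<K. v (real l * h + y)) has_integral integral {0..real K * h} v) {0..h}"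
    if "K \<le> M" for K
    using that
  proof (induction K)
    case (Suc K)
    have le: "real (Suc K) * h \<le> 1"
      using Suc.prems \<open>0 < h\<close> \<open>real M * h = 1\<close> by (metis mult_le_cancel_right_pos of_nat_le_iff)
    have K: "0 \<le> real K * h" "real K * h \<le> real (Suc K) * h"
      using \<open>0 < h\<close> by (auto intro!: mult_right_mono)
    have int: "v integrable_on {0..real (Suc K) * h}"
      by (rule integrable_on_subinterval[OF v]) (use le in auto)
    have "v integrable_on {real K * h..real (Suc K) * h}"
      by (rule integrable_on_subinterval[OF int]) (use K in auto)
    then have "(v has_integral integral {real K * h..real (Suc K) * h} v) {0 + real K * h..h + real K * h}"
      by (simp add: integrable_integral algebra_simps)
    then have "((\<lambda>y. v (real K * h + y)) has_integral integral {real K * h..real (Suc K) * h} v) {0..h}"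
      using has_integral_shift_Icc_real[of v "real K * h" _ 0 h] by (simp add: o_def)
    with Suc have "((\<lambda>y. (\<Sum>l<K. v (real l * h + y)) + v (real K * h + y)) has_integral
        (integral {0..real K * h} v + integral {real K * h..real (Suc K) * h} v)) {0..h}"
      by (intro has_integral_add) auto
    then show ?case
      using Henstock_Kurzweil_Integration.integral_combine[OF K int] by simp
  qed simp
  from this[of M] show ?thesis using assms by simp
qed

text \<open>
  The mean of \<open>sin\<close> over half a period is \<open>2 / \<pi> \<ge> 1 / 2\<close>; the subtracted \<open>1 / 4\<close> will absorb the
  influence of the other waves.
\<close>

lemma integral_half_wave_ge:
  assumes "0 < h"
  obtains J where "((\<lambda>y. sin (pi * y / h) - 1 / 4) has_integral J) {0..h}" "h / 4 \<le> J"
proof -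
  let ?F = "\<lambda>y. - (h / pi) * cos (pi * y / h) - y / 4"
  have "((\<lambda>y. sin (pi * y / h) - 1 / 4) has_integral (?F h - ?F 0)) {0..h}"
  proof (rule fundamental_theorem_of_calculus)
    fix y
    have "(?F has_real_derivative sin (pi * y / h) - 1 / 4) (at y within {0..h})"
      using assms by (auto intro!: derivative_eq_intros simp: field_simps)
    then show "(?F has_vector_derivative sin (pi * y / h) - 1 / 4) (at y within {0..h})"
      by (simp only: has_real_derivative_iff_has_vector_derivative)
  qed (use assms in simp)
  moreover have "h / 4 \<le> ?F h - ?F 0"
  proof -
    have "h * pi \<le> h * 4" using assms pi_less_4 by (intro mult_left_mono) auto
    then have "h / 2 \<le> 2 * (h / pi)" using pi_gt_zero by (simp add: field_simps)
    then show ?thesis using assms by simp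
  qed
  ultimately show thesis by (rule that)
qed

text \<open>
  Integrating the grid estimate over the offset. With \<open>2 n (m + 1) h = 1\<close> the lower bound
  \<open>n C h / 4\<close> of the integral does not depend on \<open>n\<close>.
\<close>

lemma X_norm_minus_spline_ge:
  assumes p: "1 \<le> p" and f: "continuous_on {0..1} f" and g: "g \<in> spline_space m n"
    and "1 \<le> n" and "0 < C"
    and h: "real (2 * n * (m + 1)) * h = 1"
    and wave: "\<And>i y. i < 2 * n \<Longrightarrow> 0 < y \<Longrightarrow> y < h \<Longrightarrow>
      2 ^ m * (C * (sin (pi * y / h) - 1 / 4)) \<le> \<bar>fwd_diff m h f (real (i * (m + 1)) * h + y)\<bar>"
  shows "C / (16 * real (m + 1)) \<le> X_norm p (\<lambda>x. f x - g x)"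
proof -
  let ?u = "\<lambda>x. f x - g x"
  have "0 < h"
  proof (rule zero_less_mult_pos)
    show "0 < real (2 * n * (m + 1)) * h" by (simp only: h zero_less_one)
  qed (use \<open>1 \<le> n\<close> in \<open>simp del: of_nat_mult of_nat_add\<close>)
  have "bounded (f ` {0..1})"
    by (intro compact_imp_bounded compact_continuous_image f compact_Icc)
  then have bdd: "bounded (?u ` {0..1})"
    using spline_bounded_measurable(2)[OF g] by (rule bounded_minus_comp)
  have meas: "?u \<in> borel_measurable (lebesgue_on {0..1})"
    using continuous_imp_measurable_on_sets_lebesgue[OF f] spline_bounded_measurable(1)[OF g]
    by simp
  from bdd obtain B where "\<forall>y\<in>?u ` {0..1}. norm y \<le> B" unfolding bounded_iff by blast
  then have B: "\<bar>?u x\<bar> \<le> B" if "x \<in> {0..1}" for x using that by auto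
  have int: "integrable (lebesgue_on {0..1}) (\<lambda>x. \<bar>?u x\<bar>)"
  proof (rule finite_measure.integrable_const_bound[where B = B])
    show "finite_measure (lebesgue_on {0..1::real})"
      by (rule finite_measure_lebesgue_on) simp
    show "AE x in lebesgue_on {0..1}. norm \<bar>?u x\<bar> \<le> B"
      using B by (intro AE_I2) (simp add: space_restrict_space)
  qed (use meas in measurable)
  have HK: "integral\<^sup>L (lebesgue_on {0..1}) (\<lambda>x. \<bar>?u x\<bar>) = integral {0..1} (\<lambda>x. \<bar>?u x\<bar>)"
    by (rule lebesgue_integral_eq_integral[OF int]) simp
  have "(\<lambda>x. \<bar>?u x\<bar>) integrable_on {0..1}"
    by (rule integrable_on_lebesgue_on[OF int]) simp
  then have grid: "((\<lambda>y. \<Sum>l<2 * n * (m + 1). \<bar>?u (real l * h + y)\<bar>) has_integral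
      integral {0..1} (\<lambda>x. \<bar>?u x\<bar>)) {0..h}"
    by (rule integral_eq_grid_sum[OF _ \<open>0 < h\<close> h])
  obtain J where J: "((\<lambda>y. sin (pi * y / h) - 1 / 4) has_integral J) {0..h}" "h / 4 \<le> J"
    using integral_half_wave_ge[OF \<open>0 < h\<close>] .
  have "real n * C * J \<le> integral {0..1} (\<lambda>x. \<bar>?u x\<bar>)"
  proof (rule has_integral_le[OF has_integral_mult_right[OF J(1)] grid])
    fix y assume y: "y \<in> {0..h}"
    show "real n * C * (sin (pi * y / h) - 1 / 4) \<le> (\<Sum>l<2 * n * (m + 1). \<bar>?u (real l * h + y)\<bar>)"
    proof (cases "0 < y \<and> y < h")
      case True
      then show ?thesis
        using grid_sum_lower_bound[OF g _ _ h wave, of y] by (simp add: mult.assoc)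
    next
      case False
      \<comment> \<open>At the two ends the wave vanishes, so the left-hand side is negative.\<close>
      with y have "y = 0 \<or> y = h" by auto
      then have "real n * C * (sin (pi * y / h) - 1 / 4) \<le> 0"
        using \<open>0 < C\<close> \<open>0 < h\<close> by auto
      also have "0 \<le> (\<Sum>l<2 * n * (m + 1). \<bar>?u (real l * h + y)\<bar>)"
        by (rule sum_nonneg) simp
      finally show ?thesis .
    qed
  qed
  moreover have "real n * C * (h / 4) \<le> real n * C * J"
    using J(2) \<open>0 < C\<close> by (intro mult_left_mono) auto
  moreover have "real n * C * (h / 4) = real (2 * n * (m + 1)) * h * (C / (8 * real (m + 1)))"
    by (simp add: field_simps)
  ultimately have "C / (8 * real (m + 1)) \<le> integral\<^sup>L (lebesgue_on {0..1}) (\<lambda>x. \<bar>?u x\<bar>)"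
    by (simp only: HK h mult_1_left)
  from half_integral_le_X_norm[OF p meas bdd this] show ?thesis
    using \<open>0 < C\<close> by simp
qed

section \<open>The lacunary sine series\<close>

text \<open>
  The factor \<open>1 / (16 * 4 ^ m)\<close> is small enough that, in the difference of order \<open>m\<close> resonating with
  the \<open>k\<close>th wave, the waves before it and the waves after it each contribute at most one eighth of its
  amplitude.
\<close>

locale lacunary_sine_series =
  fixes \<omega> :: "real \<Rightarrow> real" and r m :: nat and n :: "nat \<Rightarrow> nat"
  assumes modulus: "abstract_modulus \<omega>"
    and r_le_m: "1 \<le> r" "r \<le> m"
    and n_pos: "\<And>k. 1 \<le> n k" and n_mono: "strict_mono n"
    and decay: "\<And>k. \<omega> (1 / real (n (Suc k)) ^ r) \<le> 1 / (16 * 4 ^ m) * \<omega> (1 / real (n k) ^ r)"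
    and growth: "\<And>k. \<omega> (1 / real (n k) ^ r) * real (n k) ^ r
        \<le> 1 / (16 * 4 ^ m) * (\<omega> (1 / real (n (Suc k)) ^ r) * real (n (Suc k)) ^ r)"
begin

definition amplitude :: "nat \<Rightarrow> real" where
  "amplitude k = \<omega> (1 / real (n k) ^ r)"

text \<open>
  Half a period is \<open>1 / (2 (m + 1) n\<^sub>k)\<close>, so that \<open>2 n\<^sub>k\<close> cells of \<open>m + 1\<close> half periods fill \<open>[0,1]\<close>.
\<close>

definition frequency :: "nat \<Rightarrow> real" where
  "frequency k = 2 * pi * real (m + 1) * real (n k)"

definition series :: "real \<Rightarrow> real" where
  "series x = (\<Sum>k. amplitude k * sin (frequency k * x))"

lemma ratio_bounds: "0 \<le> 1 / (16 * 4 ^ m :: real)" "1 / (16 * 4 ^ m) \<le> (1 / 2 :: real)"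
proof -
  have "1 / (16 * 4 ^ m) \<le> (1 / (16 * 1) :: real)"
    by (intro divide_left_mono mult_left_mono) auto
  then show "1 / (16 * 4 ^ m) \<le> (1 / 2 :: real)" by linarith
qed simp

lemma amplitude_pos: "0 < amplitude k"
  unfolding amplitude_def using n_pos[of k] by (intro abstract_modulus_pos[OF modulus]) simp

lemma amplitude_summable: "summable amplitude"
  and amplitude_tail_le: "(\<Sum>j. amplitude (j + k)) \<le> 2 * amplitude k"
  using tail_sum[of _ amplitude, OF ratio_bounds less_imp_le[OF amplitude_pos]] decay
  unfolding amplitude_def by blast+

lemma series_sums: "(\<lambda>k. amplitude k * sin (frequency k * x)) sums series x"
  unfolding series_def
proof (intro summable_sums summable_comparison_test'[OF amplitude_summable, where N = 0])
  fix k
  show "norm (amplitude k * sin (frequency k * x)) \<le> amplitude k"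
    using amplitude_pos[of k] mult_left_mono[OF abs_sin_le_one, of "amplitude k" "frequency k * x"]
    by (simp add: abs_mult)
qed

lemma continuous_on_series: "continuous_on S series"
proof -
  have "uniform_limit S (\<lambda>K x. \<Sum>k<K. amplitude k * sin (frequency k * x)) series sequentially"
    unfolding series_def[abs_def]
  proof (rule Weierstrass_m_test[OF _ amplitude_summable])
    fix k x
    show "norm (amplitude k * sin (frequency k * x)) \<le> amplitude k"
      using amplitude_pos[of k] mult_left_mono[OF abs_sin_le_one, of "amplitude k" "frequency k * x"]
      by (simp add: abs_mult)
  qed
  then show ?thesis
    by (rule uniform_limit_theorem[rotated]) (auto intro!: always_eventually continuous_intros)
qed

text \<open>
  Termwise, the difference of the \<open>k\<close>th sine is at most \<open>(min 2 (A n\<^sub>k h))\<^sup>r \<le> A\<^sup>r min 1 (n\<^sub>k h)\<^sup>r\<close> with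
  \<open>A = 2 \<pi> (m + 1) \<ge> 2\<close>; the sum is then the lacunary one at \<open>t\<^sub>k = n\<^sub>k\<^sup>-\<^sup>r\<close> and \<open>s = h\<^sup>r\<close>.
\<close>

lemma abs_fwd_diff_series_le:
  assumes "0 < h"
  shows "\<bar>fwd_diff r h series x\<bar> \<le> 6 * (2 * pi * real (m + 1)) ^ r * \<omega> (h ^ r)"
proof -
  define A where "A = 2 * pi * real (m + 1)"
  have "2 * 1 * 1 \<le> A" unfolding A_def using pi_ge_two by (intro mult_mono) auto
  then have A: "2 \<le> A" by simp
  define t where "t k = 1 / real (n k) ^ r" for k
  have t: "0 < t k" for k using n_pos[of k] by (simp add: t_def)
  let ?d = "\<lambda>k. amplitude k * min 1 (h ^ r / t k)"
  have summand_le: "\<bar>amplitude k * fwd_diff r h (\<lambda>x. sin (frequency k * x)) x\<bar> \<le> A ^ r * ?d k" for k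
  proof -
    let ?z = "real (n k) * h"
    have z: "0 \<le> ?z" using assms by simp
    have "min 2 \<bar>frequency k * h\<bar> = min 2 (A * ?z)"
      using A assms by (simp add: frequency_def A_def abs_mult)
    also have "\<dots> \<le> A * min 1 ?z"
      using A mult_left_mono[of 1 ?z A] by (cases "?z \<le> 1") auto
    finally have "min 2 \<bar>frequency k * h\<bar> ^ r \<le> (A * min 1 ?z) ^ r"
      by (intro power_mono) auto
    also have "\<dots> \<le> A ^ r * min 1 (?z ^ r)"
    proof -
      have "min 1 ?z ^ r \<le> 1" "min 1 ?z ^ r \<le> ?z ^ r"
        using z by (auto intro!: power_le_one power_mono)
      then show ?thesis using A unfolding power_mult_distrib by (intro mult_left_mono) auto
    qed
    also have "?z ^ r = h ^ r / t k" by (simp add: t_def power_mult_distrib mult.commute)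
    finally have "\<bar>fwd_diff r h (\<lambda>x. sin (frequency k * x)) x\<bar> \<le> A ^ r * min 1 (h ^ r / t k)"
      using abs_fwd_diff_sin_le[of r h "frequency k" x] by linarith
    then show ?thesis
      using mult_left_mono[of _ _ "amplitude k"] amplitude_pos[of k]
      by (simp add: abs_mult mult.left_commute)
  qed
  have d_summable: "summable ?d"
  proof (rule summable_comparison_test'[OF amplitude_summable, where N = 0])
    fix k
    show "norm (?d k) \<le> amplitude k"
      using amplitude_pos[of k] t[of k] assms mult_left_mono[of "min 1 (h ^ r / t k)" 1 "amplitude k"]
      by (simp add: abs_mult)
  qed
  have "t \<longlonglongrightarrow> 0"
  proof -
    have "(\<lambda>j. inverse (real j ^ r)) \<longlonglongrightarrow> 0"
      using r_le_m by (intro tendsto_inverse_0_at_top filterlim_pow_at_top filterlim_real_sequentially) simp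
    then have "((\<lambda>j. inverse (real j ^ r)) \<circ> n) \<longlonglongrightarrow> 0"
      by (rule LIMSEQ_subseq_LIMSEQ[OF _ n_mono])
    then show ?thesis by (simp add: t_def[abs_def] o_def inverse_eq_divide)
  qed
  moreover have "\<omega> (t k) / t k \<le> 1 / (16 * 4 ^ m) * (\<omega> (t (Suc k)) / t (Suc k))" for k
    using growth[of k] by (simp add: t_def)
  moreover have "\<omega> (t (Suc k)) \<le> 1 / (16 * 4 ^ m) * \<omega> (t k)" for k
    using decay[of k] by (simp only: t_def)
  ultimately have "(\<Sum>k. \<omega> (t k) * min 1 (h ^ r / t k)) \<le> 6 * \<omega> (h ^ r)"
    using assms by (intro lacunary_sum_le_modulus[OF modulus ratio_bounds t]) auto
  then have total: "(\<Sum>k. ?d k) \<le> 6 * \<omega> (h ^ r)"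
    by (simp add: amplitude_def t_def)
  have sums: "(\<lambda>k. amplitude k * fwd_diff r h (\<lambda>x. sin (frequency k * x)) x) sums fwd_diff r h series x"
    by (rule fwd_diff_sums[OF series_sums])
  have summ: "summable (\<lambda>k. \<bar>amplitude k * fwd_diff r h (\<lambda>x. sin (frequency k * x)) x\<bar>)"
    by (rule summable_comparison_test'[OF summable_mult[OF d_summable, of "A ^ r"], where N = 0])
       (use summand_le in simp)
  have "\<bar>fwd_diff r h series x\<bar> \<le> (\<Sum>k. \<bar>amplitude k * fwd_diff r h (\<lambda>x. sin (frequency k * x)) x\<bar>)"
    using summable_rabs[OF summ] sums by (simp add: sums_iff)
  also have "\<dots> \<le> (\<Sum>k. A ^ r * ?d k)"
    using summand_le by (intro suminf_le summ summable_mult d_summable)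
  also have "\<dots> = A ^ r * (\<Sum>k. ?d k)" by (rule suminf_mult[OF d_summable])
  also have "\<dots> \<le> A ^ r * (6 * \<omega> (h ^ r))"
    using total A by (intro mult_left_mono) auto
  finally show ?thesis by (simp add: A_def mult_ac)
qed

text \<open>
  With \<open>h\<close> half a period of the \<open>k\<close>th wave, that wave is multiplied by \<open>(-2)\<^sup>m\<close>. Later waves are
  multiplied by at most \<open>2\<^sup>m\<close> but have small amplitudes. Earlier waves have difference at most
  \<open>(\<pi> n\<^sub>j / n\<^sub>k)\<^sup>m\<close>, and since \<open>r \<le> m\<close> their sum is at most \<open>4\<^sup>m n\<^sub>k\<^sup>-\<^sup>r \<Sum> c\<^sub>j n\<^sub>j\<^sup>r\<close>, which the growth of
  \<open>c\<^sub>j n\<^sub>j\<^sup>r\<close> makes small compared with \<open>c\<^sub>k\<close>.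
\<close>

lemma abs_fwd_diff_series_ge:
  assumes h: "frequency k * h = pi"
  shows "2 ^ m * (amplitude k * (\<bar>sin (frequency k * x)\<bar> - 1 / 4)) \<le> \<bar>fwd_diff m h series x\<bar>"
proof -
  define \<epsilon> :: real where "\<epsilon> = 1 / (16 * 4 ^ m)"
  note \<epsilon> = ratio_bounds[folded \<epsilon>_def]
  define a where "a j = amplitude j * fwd_diff m h (\<lambda>x. sin (frequency j * x)) x" for j
  have a_sums: "a sums fwd_diff m h series x"
    unfolding a_def by (rule fwd_diff_sums[OF series_sums])
  have a_le: "\<bar>a j\<bar> \<le> amplitude j * min 2 \<bar>frequency j * h\<bar> ^ m" for j
    unfolding a_def using abs_fwd_diff_sin_le[of m h "frequency j" x] amplitude_pos[of j]
    by (simp add: abs_mult)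
  have split: "fwd_diff m h series x = (\<Sum>j. a (j + Suc k)) + ((\<Sum>j<k. a j) + a k)"
    using suminf_split_initial_segment[of a "Suc k"] a_sums by (simp add: sums_iff)
  have tail: "\<bar>\<Sum>j. a (j + Suc k)\<bar> \<le> 2 * 4 ^ m * \<epsilon> * amplitude k"
  proof -
    have le: "\<bar>a j\<bar> \<le> 2 ^ m * amplitude j" for j
    proof -
      have "min 2 \<bar>frequency j * h\<bar> ^ m \<le> 2 ^ m" by (intro power_mono) auto
      with a_le[of j] amplitude_pos[of j] show ?thesis
        using mult_left_mono[of _ "2 ^ m" "amplitude j"] by (smt (verit) mult.commute)
    qed
    have summ2: "summable (\<lambda>j. 2 ^ m * amplitude (j + Suc k))"
      using amplitude_summable by (intro summable_mult summable_ignore_initial_segment)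
    have summ: "summable (\<lambda>j. \<bar>a (j + Suc k)\<bar>)"
      by (rule summable_comparison_test'[OF summ2, where N = 0]) (use le in simp)
    have "\<bar>\<Sum>j. a (j + Suc k)\<bar> \<le> (\<Sum>j. \<bar>a (j + Suc k)\<bar>)" by (rule summable_rabs[OF summ])
    also have "\<dots> \<le> (\<Sum>j. 2 ^ m * amplitude (j + Suc k))" by (intro suminf_le le summ summ2)
    also have "\<dots> = 2 ^ m * (\<Sum>j. amplitude (j + Suc k))"
      using amplitude_summable by (intro suminf_mult summable_ignore_initial_segment)
    also have "\<dots> \<le> 2 ^ m * (2 * (\<epsilon> * amplitude k))"
      using amplitude_tail_le[of "Suc k"] decay[of k] unfolding amplitude_def \<epsilon>_def
      by (intro mult_left_mono) auto
    also have "\<dots> \<le> 4 ^ m * (2 * (\<epsilon> * amplitude k))"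
      using \<epsilon> amplitude_pos[of k] by (intro mult_right_mono power_mono) auto
    finally show ?thesis by (simp add: mult_ac)
  qed
  have head: "\<bar>\<Sum>j<k. a j\<bar> \<le> 2 * 4 ^ m * \<epsilon> * amplitude k"
  proof -
    define b where "b j = amplitude j * real (n j) ^ r" for j
    have b: "0 \<le> b j" "b j \<le> \<epsilon> * b (Suc j)" for j
      using amplitude_pos[of j] growth[of j] by (auto simp: b_def \<epsilon>_def amplitude_def)
    have le: "\<bar>a j\<bar> \<le> (4 ^ m / real (n k) ^ r) * b j" if "j < k" for j
    proof -
      let ?q = "real (n j) / real (n k)"
      have q: "0 \<le> ?q" "?q \<le> 1"
        using strict_monoD[OF n_mono that] by auto
      have "frequency j * h = ?q * (frequency k * h)"
        using n_pos[of k] by (simp add: frequency_def)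
      then have "\<bar>frequency j * h\<bar> = pi * ?q" using h q by simp
      then have "min 2 \<bar>frequency j * h\<bar> ^ m \<le> (pi * ?q) ^ m"
        using q by (intro power_mono) auto
      also have "\<dots> \<le> 4 ^ m * ?q ^ r"
        unfolding power_mult_distrib using q pi_less_4 r_le_m
        by (intro mult_mono power_mono power_decreasing) auto
      finally have "\<bar>a j\<bar> \<le> amplitude j * (4 ^ m * ?q ^ r)"
        using a_le[of j] amplitude_pos[of j] mult_left_mono[of _ _ "amplitude j"] by (smt (verit))
      then show ?thesis by (simp add: b_def power_divide mult_ac)
    qed
    have "\<bar>\<Sum>j<k. a j\<bar> \<le> (\<Sum>j<k. \<bar>a j\<bar>)" by (rule sum_abs)
    also have "\<dots> \<le> (4 ^ m / real (n k) ^ r) * (\<Sum>j<k. b j)"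
      unfolding sum_distrib_left by (intro sum_mono le) simp
    also have "\<dots> \<le> (4 ^ m / real (n k) ^ r) * (2 * \<epsilon> * b k)"
      using head_sum_le[of \<epsilon> b k, OF \<epsilon> b] by (intro mult_left_mono) auto
    also have "\<dots> = 2 * 4 ^ m * \<epsilon> * amplitude k"
      using n_pos[of k] by (simp add: b_def)
    finally show ?thesis .
  qed
  have "4 ^ m * \<epsilon> = 1 / 16" by (simp add: \<epsilon>_def)
  then have "2 * 4 ^ m * \<epsilon> * amplitude k = amplitude k / 8" by simp
  with head tail have "\<bar>a k\<bar> - amplitude k / 4 \<le> \<bar>fwd_diff m h series x\<bar>"
    unfolding split by linarith
  moreover have "\<bar>a k\<bar> = 2 ^ m * (amplitude k * \<bar>sin (frequency k * x)\<bar>)"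
    unfolding a_def fwd_diff_sin_half_period[OF h] using amplitude_pos[of k]
    by (simp add: abs_mult power_abs)
  moreover have "amplitude k / 4 \<le> 2 ^ m * (amplitude k / 4)"
    using amplitude_pos[of k] by simp
  ultimately show ?thesis by (simp add: right_diff_distrib)
qed

text \<open>
  Every cell starts at a multiple of half a period, so on each of them \<open>\<bar>sin (N\<^sub>k x)\<bar>\<close> is the same
  function of the offset from the start of the cell.
\<close>

lemma series_spline_distance_ge:
  assumes "1 \<le> p" and "g \<in> spline_space m (n k)"
  shows "amplitude k / (16 * real (m + 1)) \<le> X_norm p (\<lambda>x. series x - g x)"
proof (rule X_norm_minus_spline_ge[OF assms(1) continuous_on_series assms(2) n_pos amplitude_pos])
  define h where "h = 1 / real (2 * n k * (m + 1))"
  have "frequency k = pi * real (2 * n k * (m + 1))"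
    by (simp add: frequency_def algebra_simps)
  then have freq: "frequency k * h = pi"
    using n_pos[of k] by (simp add: h_def del: of_nat_mult of_nat_add)
  have "h > 0" using n_pos[of k] by (simp add: h_def del: of_nat_mult of_nat_add)
  show "real (2 * n k * (m + 1)) * (1 / real (2 * n k * (m + 1))) = 1"
    using n_pos[of k] by (simp del: of_nat_mult of_nat_add)
  fix i y
  have wave: "frequency k * (real (i * (m + 1)) * h + y) = real (i * (m + 1)) * pi + pi * y / h"
  proof -
    have "frequency k = pi / h" using freq \<open>h > 0\<close> by (simp add: field_simps)
    then show ?thesis using \<open>h > 0\<close> by (simp add: algebra_simps)
  qed
  have "\<bar>sin (frequency k * (real (i * (m + 1)) * h + y))\<bar> = \<bar>sin (pi * y / h)\<bar>"
    unfolding wave sin_add sin_npi cos_npi by (simp add: abs_mult power_abs)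
  then have "2 ^ m * (amplitude k * (sin (pi * y / h) - 1 / 4))
      \<le> 2 ^ m * (amplitude k * (\<bar>sin (frequency k * (real (i * (m + 1)) * h + y))\<bar> - 1 / 4))"
    using amplitude_pos[of k] by (intro mult_left_mono) auto
  also have "\<dots> \<le> \<bar>fwd_diff m h series (real (i * (m + 1)) * h + y)\<bar>"
    by (rule abs_fwd_diff_series_ge[OF freq])
  finally show "2 ^ m * (amplitude k * (sin (pi * y / (1 / real (2 * n k * (m + 1)))) - 1 / 4))
      \<le> \<bar>fwd_diff m (1 / real (2 * n k * (m + 1))) series
           (real (i * (m + 1)) * (1 / real (2 * n k * (m + 1))) + y)\<bar>"
    unfolding h_def .
qed

lemma smoothness_modulus_series_bigo:
  assumes "1 \<le> p"
  shows "(\<lambda>\<delta>. smoothness_modulus r p series \<delta>) \<in> O[at_right 0](\<lambda>\<delta>. \<omega> (\<delta> ^ r))"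
proof (rule landau_o.bigI[where c = "6 * (2 * pi * real (m + 1)) ^ r"])
  show "\<forall>\<^sub>F \<delta> in at_right 0. norm (smoothness_modulus r p series \<delta>)
      \<le> 6 * (2 * pi * real (m + 1)) ^ r * norm (\<omega> (\<delta> ^ r))"
    using eventually_at_right_less[of 0]
  proof eventually_elim
    case (elim \<delta>)
    have "\<bar>smoothness_modulus r p series \<delta>\<bar> \<le> 6 * (2 * pi * real (m + 1)) ^ r * \<omega> (\<delta> ^ r)"
    proof (rule smoothness_modulus_le[OF assms elim])
      fix x h assume h: "0 < h" "h \<le> \<delta>"
      then have "\<omega> (h ^ r) \<le> \<omega> (\<delta> ^ r)"
        by (intro abstract_modulus_mono[OF modulus] power_mono) auto
      then have "6 * (2 * pi * real (m + 1)) ^ r * \<omega> (h ^ r)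
          \<le> 6 * (2 * pi * real (m + 1)) ^ r * \<omega> (\<delta> ^ r)"
        by (intro mult_left_mono) auto
      with abs_fwd_diff_series_le[OF h(1), of x]
      show "\<bar>fwd_diff r h series x\<bar> \<le> 6 * (2 * pi * real (m + 1)) ^ r * \<omega> (\<delta> ^ r)"
        by linarith
    qed
    then show ?case
      using abstract_modulus_pos[OF modulus, of "\<delta> ^ r"] elim by simp
  qed
qed simp

lemma best_approx_error_series_not_smallo:
  assumes "1 \<le> p" "1 \<le> r'" "r' \<le> m"
  shows "(\<lambda>n. best_approx_error p (spline_space r' n) series) \<notin> o(\<lambda>n. \<omega> (1 / real n ^ r))"
proof
  assume "(\<lambda>n. best_approx_error p (spline_space r' n) series) \<in> o(\<lambda>n. \<omega> (1 / real n ^ r))"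
  then have "\<forall>\<^sub>F j in sequentially. norm (best_approx_error p (spline_space r' j) series)
      \<le> 1 / (32 * real (m + 1)) * norm (\<omega> (1 / real j ^ r))"
    by (rule landau_o.smallD) simp
  then have "\<forall>\<^sub>F k in sequentially. norm (best_approx_error p (spline_space r' (n k)) series)
      \<le> 1 / (32 * real (m + 1)) * norm (\<omega> (1 / real (n k) ^ r))"
    by (rule eventually_subseq[OF n_mono])
  then obtain k where "norm (best_approx_error p (spline_space r' (n k)) series)
      \<le> 1 / (32 * real (m + 1)) * norm (amplitude k)"
    unfolding amplitude_def using eventually_happens by force
  then have "best_approx_error p (spline_space r' (n k)) series
      \<le> 1 / (32 * real (m + 1)) * amplitude k"
    using amplitude_pos[of k] by simp
  also have "\<dots> < amplitude k / (16 * real (m + 1))"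
    using amplitude_pos[of k] by (simp add: field_simps add_pos_nonneg)
  also have "\<dots> \<le> best_approx_error p (spline_space r' (n k)) series"
    unfolding best_approx_error_def
  proof (rule cINF_greatest[OF spline_space_nonempty[OF assms(2)]])
    fix g assume "g \<in> spline_space r' (n k)"
    then have "g \<in> spline_space m (n k)" using spline_space_mono[OF assms(3)] by blast
    then show "amplitude k / (16 * real (m + 1)) \<le> X_norm p (\<lambda>x. series x - g x)"
      by (rule series_spline_distance_ge[OF assms(1)])
  qed
  finally show False by simp
qed

end

section \<open>Sharpness of the direct estimate for free-knot piecewise polynomials\<close>

theorem corollary4p1:
  fixes r r' :: nat and p :: ennreal and \<omega> :: "real \<Rightarrow> real"
  assumes "r \<ge> 1" and "r' \<ge> 1" and "1 \<le> p"
    and "abstract_modulus \<omega>"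
    and "filterlim (\<lambda>\<delta>. \<omega> \<delta> / \<delta>) at_top (at_right 0)"
  shows "\<exists>f \<in> X_space p.
           (\<lambda>\<delta>. smoothness_modulus r p f \<delta>) \<in> O[at_right 0](\<lambda>\<delta>. \<omega> (\<delta> ^ r)) \<and>
           (\<lambda>n. best_approx_error p (spline_space r' n) f) \<notin> o(\<lambda>n. \<omega> (1 / real n ^ r))"
proof -
  define m where "m = max r r'"
  have \<epsilon>: "(0::real) < 1 / (16 * 4 ^ m)" by simp
  obtain n :: "nat \<Rightarrow> nat" where n: "\<And>k. 1 \<le> n k" "strict_mono n"
    "\<And>k. \<omega> (1 / real (n (Suc k)) ^ r) \<le> 1 / (16 * 4 ^ m) * \<omega> (1 / real (n k) ^ r)"
    "\<And>k. \<omega> (1 / real (n k) ^ r) * real (n k) ^ r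
        \<le> 1 / (16 * 4 ^ m) * (\<omega> (1 / real (n (Suc k)) ^ r) * real (n (Suc k)) ^ r)"
    using exists_lacunary_sequence[OF assms(4,5,1) \<epsilon>] by blast
  have "r \<le> m" by (simp add: m_def)
  have lac: "lacunary_sine_series \<omega> r m n"
    by (rule lacunary_sine_series.intro[OF assms(4,1) \<open>r \<le> m\<close> n])
  have "r' \<le> m" by (simp add: m_def)
  show ?thesis
    using continuous_in_X_space[OF lacunary_sine_series.continuous_on_series[OF lac]]
      lacunary_sine_series.smoothness_modulus_series_bigo[OF lac assms(3)]
      lacunary_sine_series.best_approx_error_series_not_smallo[OF lac assms(3,2) \<open>r' \<le> m\<close>]
    by blast
qed

end
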